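(* Let $L>0$ and $x^*\in\mathbb{R}^d$. Let $F:\mathbb{R}^d\to\mathbb{R}^d$ be $L$-Lipschitz and star-monotone around $x^*$, i.e. $F(x^* )=0$ and $\langle F(x),x-x^*\rangle\ge 0$ for all $x\in\mathbb{R}^d$. Then for every $0<\gamma\le\frac1L$ the operator $F_{\mathrm{EG},\gamma}$ defined by $F_{\mathrm{EG},\gamma}(x)=F(x-\gamma F(x))$ is $\frac{2}{\gamma}$-star-cocoercive around $x^*$.
   Context: $\langle\cdot,\cdot\rangle$ and $\|\cdot\|$ are the standard Euclidean inner product and norm. $F$ is $L$-Lipschitz if $\|F(x)-F(x')\|\le L\|x-x'\|$ for all $x,x'$. An operator $G:\mathbb{R}^d\to\mathbb{R}^d$ is $\ell$-star-cocoercive around $x^*$ if $G(x^* )=0$ and $\|G(x)\|^2\le\ell\langle G(x),x-x^*\rangle$ for all $x\in\mathbb{R}^d$. *)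

theory Defs
  imports "HOL-Analysis.Analysis"
begin

definition star_monotone :: "('a::real_inner \<Rightarrow> 'a) \<Rightarrow> 'a \<Rightarrow> bool" where
  "star_monotone F xs \<longleftrightarrow> F xs = 0 \<and> (\<forall>x. F x \<bullet> (x - xs) \<ge> 0)"

definition star_cocoercive :: "real \<Rightarrow> ('a::real_inner \<Rightarrow> 'a) \<Rightarrow> 'a \<Rightarrow> bool" where
  "star_cocoercive l G xs \<longleftrightarrow>
     G xs = 0 \<and> (\<forall>x. (norm (G x))\<^sup>2 \<le> l * (G x \<bullet> (x - xs)))"

text \<open>The extragradient operator with step size \<open>\<gamma>\<close>.\<close>

definition F_EG :: "('a::real_vector \<Rightarrow> 'a) \<Rightarrow> real \<Rightarrow> 'a \<Rightarrow> 'a" where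
  "F_EG F \<gamma> x = F (x - \<gamma> *\<^sub>R F x)"

end

theory Submission
  imports Defs
begin

text \<open>Put \<open>y = x - \<gamma> *\<^sub>R F x\<close>. Since L\<gamma> \<le> 1, the
  Lipschitz bound keeps F y within distance |F x| of F x, and
  \<open>norm_sq_le_inner_of_dist_le\<close> turns this into |F y|^2 \<le> 2 <F x, F y>. As x - xs =
  (y - xs) + \<gamma> F x, star-monotonicity at y gives \<gamma> <F x, F y> \<le> <F y, x - xs>.
  Combining the two yields the constant 2/\<gamma>.\<close>

lemma norm_sq_le_inner_of_dist_le:
  fixes a b :: "'a::real_inner"
  assumes "dist a b \<le> norm a"
  shows "(norm b)\<^sup>2 \<le> 2 * (a \<bullet> b)"
proof -
  have "(norm (a - b))\<^sup>2 \<le> (norm a)\<^sup>2"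
    using assms by (intro power_mono) (auto simp: dist_norm)
  \<comment> \<open>Expanding the left square, |a|^2 cancels and |b|^2 - 2 <a, b> \<le> 0
    remains.\<close>
  then show ?thesis
    by (simp add: power2_norm_eq_inner inner_diff_left inner_diff_right inner_commute)
qed

theorem lemma3p1:
  fixes F :: "real ^ 'd \<Rightarrow> real ^ 'd" and xs :: "real ^ 'd" and L :: real
  assumes "L > 0"
    and "L-lipschitz_on UNIV F"
    and "star_monotone F xs"
  shows "\<forall>\<gamma>::real. 0 < \<gamma> \<and> \<gamma> \<le> 1 / L \<longrightarrow> star_cocoercive (2 / \<gamma>) (F_EG F \<gamma>) xs"
proof (intro allI impI)
  fix \<gamma> :: real
  assume \<gamma>: "0 < \<gamma> \<and> \<gamma> \<le> 1 / L"
  have zero: "F xs = 0" and mono: "\<And>x. F x \<bullet> (x - xs) \<ge> 0"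
    using assms(3) by (auto simp: star_monotone_def)
  have "(norm (F_EG F \<gamma> x))\<^sup>2 \<le> 2 / \<gamma> * (F_EG F \<gamma> x \<bullet> (x - xs))" for x
  proof -
    define y where "y = x - \<gamma> *\<^sub>R F x"
    have "dist (F x) (F y) \<le> L * dist x y"
      using assms(2) by (rule lipschitz_onD) auto
    also have "\<dots> = (L * \<gamma>) * norm (F x)"
      using \<gamma> by (simp add: y_def dist_norm)
    \<comment> \<open>The upper bound on the step size enters here, as L\<gamma> \<le> 1.\<close>
    also have "\<dots> \<le> 1 * norm (F x)"
      using \<gamma> assms(1) by (intro mult_right_mono) (auto simp: field_simps)
    finally have "(norm (F y))\<^sup>2 \<le> 2 * (F x \<bullet> F y)"
      by (intro norm_sq_le_inner_of_dist_le) simp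
    \<comment> \<open>The factor \<gamma> is inserted to produce the displacement x - y = \<gamma> F
      x.\<close>
    also have "\<dots> = 2 / \<gamma> * (\<gamma> * (F x \<bullet> F y))"
      using \<gamma> by simp
    also have "\<dots> \<le> 2 / \<gamma> * (F y \<bullet> (x - xs))"
    proof (rule mult_left_mono)
      \<comment> \<open>Splitting at y leaves a first term that is nonnegative by star-monotonicity
        at y.\<close>
      have "F y \<bullet> (x - xs) = F y \<bullet> (y - xs) + \<gamma> * (F x \<bullet> F y)"
        by (simp add: y_def inner_diff_left inner_diff_right inner_commute)
      then show "\<gamma> * (F x \<bullet> F y) \<le> F y \<bullet> (x - xs)"
        using mono[of y] by simp
    qed (use \<gamma> in simp)
    finally show ?thesis
      by (simp add: F_EG_def y_def)
  qed
  \<comment> \<open>The extrapolation step fixes xs because F vanishes there, so xs is also a zero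
    of \<open>F_EG F \<gamma>\<close>.\<close>
  then show "star_cocoercive (2 / \<gamma>) (F_EG F \<gamma>) xs"
    by (simp add: star_cocoercive_def F_EG_def zero)
qed

end
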